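(* Let $N\ge 2$ be an integer and let $\beta\ge 0$ be fixed. Let $a_1,\dots,a_N>0$ and let $h>0$ be such that the box $\Omega(a_1,\dots,a_N)$ and the cube $\Omega(h,\dots,h)$ have the same perimeter, $|\partial\Omega(a_1,\dots,a_N)|=|\partial\Omega(h,\dots,h)|$. Then $$\lambda_1\bigl(\Omega(a_1,\dots,a_N)\bigr)\ \ge\ \lambda_1\bigl(\Omega(h,\dots,h)\bigr).$$ That is, amongst all boxes with a given perimeter, the cube has the smallest fundamental Robin eigenvalue.
   Context: For $\mathbf a=(a_1,\dots,a_N)$ with all $a_j>0$, the box is $\Omega(\mathbf a)=(-a_1,a_1)\times\cdots\times(-a_N,a_N)\subset\mathbb{R}^N$. Its perimeter $|\partial\Omega(\mathbf a)|$ is the $(N-1)$-dimensional measure of its boundary, $|\partial\Omega(\mathbf a)|=2\sum_{j=1}^N\prod_{i\ne j}(2a_i)$. For given $\beta\ge 0$, $\lambda_1(\Omega)$ denotes the fundamental (smallest) Robin eigenvalue of the Laplacian, i.e. the smallest $\lambda$ for which there is a function $u$, not identically zero, with $\Delta u+\lambda u=0$ in $\Omega$ and $\beta\,\partial u/\partial n+u=0$ on $\partial\Omega$ ($n$ the outward normal). For boxes it is given by the explicit formula $$\lambda_1(\Omega(\mathbf a))=\sum_{j=1}^N\mu(a_j)^2,$$ where, if $\beta>0$, $\mu(c)$ is the unique solution in $(0,\pi/(2c))$ of $\mu\tan(c\mu)=1/\beta$, and, if $\beta=0$, $\mu(c)=\pi/(2c)$. *)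

theory Defs
  imports "HOL-Analysis.Analysis"
begin

text \<open>A vector \<open>a\<close> with positive entries stands for the box
  \<open>(-a\<^sub>1, a\<^sub>1) \<times> \<dots> \<times> (-a\<^sub>N, a\<^sub>N)\<close>, where \<open>N = CARD('n)\<close>.\<close>

definition centred_box :: "real ^ 'n \<Rightarrow> (real ^ 'n) set" where
  "centred_box a = box (- a) a"


text \<open>For a set inside a hyperplane \<open>{x. x $ j = c}\<close>, this is its \<open>(N-1)\<close>-dimensional Lebesgue
  measure: dropping the \<open>j\<close>-th coordinate is an isometry onto \<open>(N-1)\<close>-dimensional space.\<close>

definition hyperplane_measure :: "'n \<Rightarrow> (real ^ 'n) set \<Rightarrow> real" where
  "hyperplane_measure j S =
     measure (\<Pi>\<^sub>M i\<in>UNIV - {j}. lborel) ((\<lambda>x. restrict (($) x) (UNIV - {j})) ` S)"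

text \<open>The boundary of the box is the union of its \<open>2N\<close> faces, which overlap only in sets of
  \<open>(N-1)\<close>-dimensional measure zero. (For \<open>a $ j > 0\<close> the index set \<open>{- a $ j, a $ j}\<close> has two
  elements.)\<close>

definition box_perimeter :: "real ^ 'n \<Rightarrow> real" where
  "box_perimeter a =
     (\<Sum>j\<in>UNIV. \<Sum>c\<in>{- a $ j, a $ j}.
        hyperplane_measure j {x \<in> frontier (centred_box a). x $ j = c})"

lemma face_eq:
  fixes a :: "real ^ 'n"
  assumes pos: "\<And>i. a $ i > 0" and c: "c \<in> {- a $ j, a $ j}"
  shows "{x \<in> frontier (centred_box a). x $ j = c}
         = {x. x $ j = c \<and> (\<forall>i. - a $ i \<le> x $ i \<and> x $ i \<le> a $ i)}"
proof -
  have "box (- a) a \<noteq> {}"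
    using pos by (auto simp: box_ne_empty Basis_vec_def inner_axis intro: order.strict_trans[of _ 0])
  then have "frontier (box (- a) a) = cbox (- a) a - box (- a) a"
    by (simp add: frontier_def interior_open[OF open_box])
  then show ?thesis
    using c by (auto simp: centred_box_def mem_box_cart intro!: exI[of _ j])
qed

lemma hyperplane_measure_face:
  fixes a :: "real ^ 'n"
  assumes pos: "\<And>i. a $ i > 0" and c: "c \<in> {- a $ j, a $ j}"
  shows "hyperplane_measure j {x \<in> frontier (centred_box a). x $ j = c}
         = (\<Prod>i\<in>UNIV - {j}. 2 * a $ i)"
proof -
  interpret product_sigma_finite "\<lambda>_ :: 'n. lborel :: real measure" ..
  have *: "(\<lambda>x. restrict (($) x) (UNIV - {j})) `
      {x. x $ j = c \<and> (\<forall>i. - a $ i \<le> x $ i \<and> x $ i \<le> a $ i)}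
     = (\<Pi>\<^sub>E i\<in>UNIV - {j}. {- a $ i .. a $ i})" (is "?f ` ?L = ?R")
  proof (rule equalityI)
    show "?f ` ?L \<subseteq> ?R" by (auto split: if_splits)
    show "?R \<subseteq> ?f ` ?L"
    proof
      fix y assume y: "y \<in> ?R"
      define x where "x = (\<chi> i. if i = j then c else y i)"
      have "y = ?f x" using y by (auto simp: x_def fun_eq_iff PiE_def extensional_def)
      moreover have "x \<in> ?L"
        using y c pos[of j] by (auto simp: x_def PiE_def Pi_def less_imp_le)
      ultimately show "y \<in> ?f ` ?L" by blast
    qed
  qed
  have "emeasure (\<Pi>\<^sub>M i\<in>UNIV - {j}. lborel) ?R = (\<Prod>i\<in>UNIV - {j}. emeasure lborel {- a $ i .. a $ i})"
    by (rule emeasure_PiM) auto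
  also have "\<dots> = (\<Prod>i\<in>UNIV - {j}. ennreal (2 * a $ i))"
    using pos by (intro prod.cong) (auto simp: less_imp_le)
  also have "\<dots> = ennreal (\<Prod>i\<in>UNIV - {j}. 2 * a $ i)"
    using pos by (intro prod_ennreal) (simp add: less_imp_le)
  finally show ?thesis
    unfolding hyperplane_measure_def face_eq[OF assms] *
    using pos by (simp add: measure_def prod_nonneg less_imp_le)
qed

lemma box_perimeter_eq:
  fixes a :: "real ^ 'n"
  assumes "\<And>i. a $ i > 0"
  shows "box_perimeter a = 2 * (\<Sum>j\<in>UNIV. \<Prod>i\<in>UNIV - {j}. 2 * a $ i)"
proof -
  have "(\<Sum>c\<in>{- a $ j, a $ j}. hyperplane_measure j {x \<in> frontier (centred_box a). x $ j = c})
      = 2 * (\<Prod>i\<in>UNIV - {j}. 2 * a $ i)" for j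
  proof -
    have "(\<Sum>c\<in>{- a $ j, a $ j}. hyperplane_measure j {x \<in> frontier (centred_box a). x $ j = c})
       = (\<Sum>c\<in>{- a $ j, a $ j}. \<Prod>i\<in>UNIV - {j}. 2 * a $ i)"
      using hyperplane_measure_face[of a, OF assms] by (intro sum.cong) auto
    also have "\<dots> = 2 * (\<Prod>i\<in>UNIV - {j}. 2 * a $ i)"
      using assms[of j] by (subst sum.insert) auto
    finally show ?thesis .
  qed
  then show ?thesis by (simp add: box_perimeter_def sum_distrib_left)
qed


text \<open>\<open>n\<close> is the outward unit normal of \<open>\<Omega>\<close> at a point \<open>x\<close> where the boundary is \<open>C\<^sup>1\<close>: near \<open>x\<close>,
  \<open>\<Omega>\<close> is the sublevel set \<open>{\<rho> < 0}\<close> of a \<open>C\<^sup>1\<close> function with gradient \<open>g\<close>, \<open>g x \<noteq> 0\<close>. There is no such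
  \<open>n\<close> at the edges and corners of a box.\<close>

definition outward_normal :: "(real ^ 'n) set \<Rightarrow> real ^ 'n \<Rightarrow> real ^ 'n \<Rightarrow> bool" where
  "outward_normal \<Omega> x n \<longleftrightarrow>
     x \<in> frontier \<Omega> \<and>
     (\<exists>r>0. \<exists>\<rho> :: real ^ 'n \<Rightarrow> real. \<exists>g :: real ^ 'n \<Rightarrow> real ^ 'n.
        (\<forall>y\<in>ball x r. (\<rho> has_derivative (\<lambda>v. g y \<bullet> v)) (at y)) \<and>
        continuous_on (ball x r) g \<and> g x \<noteq> 0 \<and>
        \<Omega> \<inter> ball x r = {y \<in> ball x r. \<rho> y < 0} \<and>
        n = g x /\<^sub>R norm (g x))"

text \<open>\<open>u\<close> is a classical solution, in \<open>C\<^sup>2(\<Omega>) \<inter> C\<^sup>1(closure \<Omega>)\<close>, of \<open>\<Delta>u + \<lambda>u = 0\<close> in \<open>\<Omega>\<close> and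
  \<open>\<beta> \<partial>u/\<partial>n + u = 0\<close> on \<open>\<partial>\<Omega>\<close>, not identically zero. Here \<open>g\<close> is the gradient of \<open>u\<close> (on the boundary,
  its continuous extension), \<open>H\<close> the Hessian matrix, and \<open>trace (H x)\<close> the Laplacian.\<close>

definition robin_eigenfunction ::
    "real \<Rightarrow> (real ^ 'n) set \<Rightarrow> real \<Rightarrow> (real ^ 'n \<Rightarrow> real) \<Rightarrow> bool" where
  "robin_eigenfunction \<beta> \<Omega> l u \<longleftrightarrow>
     (\<exists>g :: real ^ 'n \<Rightarrow> real ^ 'n. \<exists>H :: real ^ 'n \<Rightarrow> real ^ 'n ^ 'n.
        (\<forall>x\<in>\<Omega>. (u has_derivative (\<lambda>v. g x \<bullet> v)) (at x)) \<and>
        (\<forall>x\<in>\<Omega>. (g has_derivative (\<lambda>v. H x *v v)) (at x)) \<and>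
        continuous_on \<Omega> H \<and>
        continuous_on (closure \<Omega>) u \<and> continuous_on (closure \<Omega>) g \<and>
        (\<forall>x\<in>\<Omega>. trace (H x) + l * u x = 0) \<and>
        (\<forall>x n. outward_normal \<Omega> x n \<longrightarrow> \<beta> * (g x \<bullet> n) + u x = 0)) \<and>
     (\<exists>x\<in>\<Omega>. u x \<noteq> 0)"

definition robin_eigenvalue :: "real \<Rightarrow> (real ^ 'n) set \<Rightarrow> real \<Rightarrow> bool" where
  "robin_eigenvalue \<beta> \<Omega> l \<longleftrightarrow> (\<exists>u. robin_eigenfunction \<beta> \<Omega> l u)"

definition fundamental_robin_eigenvalue :: "real \<Rightarrow> (real ^ 'n) set \<Rightarrow> real" where
  "fundamental_robin_eigenvalue \<beta> \<Omega> = (LEAST l. robin_eigenvalue \<beta> \<Omega> l)"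

end

theory Submission
  imports Defs
begin

text \<open>Separation of variables suggests that the fundamental eigenvalue of the box with half-widths
  \<open>a\<^sub>j\<close> is \<open>\<Sum>j. \<mu>(a\<^sub>j)\<^sup>2\<close>, where \<open>\<mu>(c)\<close> is the least positive frequency \<open>\<nu>\<close> for which
  \<open>cos (\<nu> t)\<close> satisfies the Robin condition at \<open>t = \<plusminus>c\<close>. Once this is known, the theorem is a
  convexity statement about \<open>\<mu>\<close>.

  \<^emph>\<open>The eigenvalue.\<close> The product \<open>\<Prod>j. cos (\<mu>(a\<^sub>j) x\<^sub>j)\<close> is an eigenfunction
  (\<open>robin_eigenvalue_box\<close>). No eigenvalue is smaller (\<open>robin_eigenvalue_box_ge\<close>), by a maximum
  principle: lowering all frequencies by a factor \<open>t < 1\<close> gives a function \<open>\<phi>\<close> that is positive on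
  the closed box and satisfies the boundary condition with strict inequality, and for an eigenfunction
  \<open>u\<close> with \<open>u > 0\<close> somewhere one looks at a point where \<open>u / \<phi>\<close> is maximal. With the maximum \<open>M\<close>,
  the function \<open>u - M \<phi>\<close> is nonpositive and vanishes there. At a boundary point it would
  strictly increase on entering the box, so the point is interior. There its Laplacian is nonpositive,
  which bounds the eigenvalue of \<open>u\<close> below by \<open>t\<^sup>2 (\<Sum>j. \<mu>(a\<^sub>j)\<^sup>2)\<close> (\<open>supersolution_eigenvalue_bound\<close>).

  \<^emph>\<open>The inequality.\<close> The function \<open>c \<mapsto> \<mu>(c)\<^sup>2\<close> is decreasing and is convex as a function of \<open>ln c\<close>, so it
  lies above its tangent at \<open>ln h\<close>, which has a slope \<open>-K \<le> 0\<close> (\<open>robin_frequency_tangent\<close>). Summation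
  over the sides gives \<open>\<Sum>j. \<mu>(a\<^sub>j)\<^sup>2 \<ge> N \<mu>(h)\<^sup>2 - K (\<Sum>j. ln a\<^sub>j - ln h)\<close>, and by the arithmetic-geometric mean
  inequality applied to the areas of the faces, a box with the same perimeter as the cube has no larger
  volume, that is, \<open>\<Sum>j. ln a\<^sub>j - ln h \<le> 0\<close> (\<open>equal_perimeter_sum_ln\<close>).\<close>

section \<open>Frequencies of the one-dimensional Robin problem\<close>

text \<open>The Robin condition \<open>\<beta> u' + u = 0\<close> for \<open>u t = cos (\<nu> t)\<close> at \<open>t = c\<close>, with denominators cleared in
  \<open>\<nu> tan (c \<nu>) = 1 / \<beta>\<close>. This form also makes sense for \<open>\<beta> = 0\<close>, where it forces \<open>c \<nu> = pi / 2\<close>; for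
  \<open>\<beta> > 0\<close> it excludes that endpoint.\<close>

definition robin_frequency :: "real \<Rightarrow> real \<Rightarrow> real \<Rightarrow> bool" where
  "robin_frequency \<beta> c \<nu> \<longleftrightarrow>
     0 < \<nu> \<and> c * \<nu> \<le> pi / 2 \<and> \<beta> * \<nu> * sin (c * \<nu>) = cos (c * \<nu>)"

lemma robin_frequency_exists:
  assumes "\<beta> \<ge> 0" "c > 0"
  shows "\<exists>\<nu>. robin_frequency \<beta> c \<nu>"
proof -
  let ?f = "\<lambda>\<nu>. \<beta> * \<nu> * sin (c * \<nu>) - cos (c * \<nu>)"
  have "\<exists>\<nu>\<ge>0. \<nu> \<le> pi / (2 * c) \<and> ?f \<nu> = 0"
    using assms by (intro IVT) (auto intro!: continuous_intros)
  then obtain \<nu> where \<nu>: "\<nu> \<ge> 0" "\<nu> \<le> pi / (2 * c)" "?f \<nu> = 0" by blast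
  moreover from \<nu>(3) have "\<nu> \<noteq> 0" by (intro notI) simp
  ultimately show ?thesis
    using assms by (intro exI[of _ \<nu>]) (auto simp: robin_frequency_def field_simps)
qed

section \<open>Logarithmic convexity of the squared frequency\<close>

lemma tan_over_id_mono:
  fixes x y :: real
  assumes "0 < x" "x \<le> y" "y < pi / 2"
  shows "tan x / x \<le> tan y / y"
proof (rule DERIV_nonneg_imp_nondecreasing[OF \<open>x \<le> y\<close>])
  fix t assume t: "x \<le> t" "t \<le> y"
  then have pos: "0 < t" "0 < cos t" using assms by (auto intro!: cos_gt_zero)
  have "((\<lambda>t. tan t / t) has_real_derivative (t - sin t * cos t) / (t * cos t)\<^sup>2) (at t)"
  proof -
    have "((\<lambda>t. tan t / t) has_real_derivative (1 / (cos t)\<^sup>2 * t - tan t) / t\<^sup>2) (at t)"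
      using pos by (auto intro!: derivative_eq_intros simp: power2_eq_square inverse_eq_divide)
    also have "(1 / (cos t)\<^sup>2 * t - tan t) / t\<^sup>2 = (t - sin t * cos t) / (t * cos t)\<^sup>2"
      using pos by (simp add: tan_def field_simps power2_eq_square)
    finally show ?thesis .
  qed
  moreover have "sin t * cos t \<le> t * 1"
    using pos sin_x_le_x[of t] by (intro mult_mono) auto
  ultimately show "\<exists>d. ((\<lambda>t. tan t / t) has_real_derivative d) (at t) \<and> 0 \<le> d"
    by force
qed

text \<open>For \<open>\<beta> > 0\<close>, put \<open>y = c \<nu>\<close>. The defining equation becomes \<open>c = \<beta> (y tan y)\<close> and \<open>\<nu> = cot y / \<beta>\<close>, so
  \<open>\<nu>\<^sup>2\<close> as a function of \<open>ln c\<close> is the curve \<open>(ln (y tan y), cot\<^sup>2 y)\<close>, up to a translation and a factor.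
  Its slope, the quotient of the derivatives with respect to \<open>y\<close>, is \<open>- 2 / slope_recip y\<close>. In the
  form below, \<open>slope_recip\<close> is visibly increasing, and this is the convexity of the curve.\<close>

definition slope_recip :: "real \<Rightarrow> real" where
  "slope_recip y = (tan y)\<^sup>2 + (sin y)\<^sup>2 * (tan y / y)"

lemma slope_recip_pos: "0 < y \<Longrightarrow> y < pi / 2 \<Longrightarrow> 0 < slope_recip y"
  unfolding slope_recip_def using tan_gt_zero[of y] by (intro add_pos_nonneg) auto

lemma slope_recip_mono:
  assumes "0 < x" "x \<le> y" "y < pi / 2"
  shows "slope_recip x \<le> slope_recip y"
proof -
  have "tan x \<le> tan y" "sin x \<le> sin y" "0 < tan x" "0 < sin x"
    using assms by (auto intro!: tan_mono_le sin_monotone_2pi_le tan_gt_zero sin_gt_zero)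
  then show ?thesis
    unfolding slope_recip_def using tan_over_id_mono[OF assms] assms
    by (intro add_mono mult_mono power_mono) auto
qed

text \<open>Along the curve, the difference of the two sides has a derivative with the sign of the difference of
  slopes \<open>1 / slope_recip z - 1 / slope_recip y\<close>. Hence it decreases up to \<open>y = z\<close> and increases afterwards,
  and its minimum at \<open>y = z\<close> is zero.\<close>

lemma cot_square_tangent:
  fixes y z :: real
  assumes y: "0 < y" "y < pi / 2" and z: "0 < z" "z < pi / 2"
  shows "(1 / tan z)\<^sup>2 - 2 / slope_recip z * (ln (y * tan y) - ln (z * tan z)) \<le> (1 / tan y)\<^sup>2"
proof -
  define k where "k = 1 / slope_recip z"
  define G where "G = (\<lambda>t. (1 / tan t)\<^sup>2 + 2 * k * (ln t + ln (tan t)))"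
  have der: "(G has_real_derivative 2 * (1 / t + 1 / (sin t * cos t)) * (k - 1 / slope_recip t)) (at t)"
    and pos: "0 \<le> 2 * (1 / t + 1 / (sin t * cos t))"
    if t: "0 < t" "t < pi / 2" for t
  proof -
    have p: "0 < tan t" "0 < sin t" "0 < cos t"
      using t by (auto intro: tan_gt_zero sin_gt_zero cos_gt_zero)
    then have [simp]: "tan t \<noteq> 0" "sin t \<noteq> 0" "cos t \<noteq> 0" "t \<noteq> 0" using t by auto
    have "sin t * cos t + t \<noteq> 0" using p t by (metis add_pos_pos less_numeral_extra(3) mult_pos_pos)
    moreover have "slope_recip t = (sin t)\<^sup>2 * (sin t * cos t + t) / (t * (cos t)\<^sup>2)"
      by (simp add: slope_recip_def tan_def field_simps power2_eq_square)
    moreover have "1 / t + 1 / (sin t * cos t) = (sin t * cos t + t) / (t * (sin t * cos t))"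
      by (simp add: field_simps)
    ultimately have s: "(1 / t + 1 / (sin t * cos t)) * (1 / slope_recip t) = cos t / sin t ^ 3"
      by (simp add: power2_eq_square power3_eq_cube)
    have "(G has_real_derivative (2 * (1 / tan t) * (- (1 / (cos t)\<^sup>2) / (tan t)\<^sup>2) +
        2 * k * (1 / t + 1 / (cos t)\<^sup>2 / tan t))) (at t)"
      unfolding G_def using p t
      by (auto intro!: derivative_eq_intros simp: power2_eq_square inverse_eq_divide mult_ac)
    also have "2 * (1 / tan t) * (- (1 / (cos t)\<^sup>2) / (tan t)\<^sup>2) + 2 * k * (1 / t + 1 / (cos t)\<^sup>2 / tan t)
       = 2 * k * (1 / t + 1 / (sin t * cos t)) - 2 * (cos t / sin t ^ 3)"
    proof -
      have "1 / (cos t)\<^sup>2 / tan t = 1 / (sin t * cos t)"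
        unfolding tan_def by (simp add: divide_simps power2_eq_square)
      moreover have "1 / tan t * (- (1 / (cos t)\<^sup>2) / (tan t)\<^sup>2) = - (cos t / sin t ^ 3)"
        unfolding tan_def by (simp add: divide_simps power2_eq_square power3_eq_cube)
      ultimately show ?thesis by (simp only: mult.assoc)
    qed
    also have "\<dots> = 2 * (1 / t + 1 / (sin t * cos t)) * (k - 1 / slope_recip t)"
      unfolding s[symmetric] by (simp only: right_diff_distrib left_diff_distrib mult_ac)
    finally show "(G has_real_derivative 2 * (1 / t + 1 / (sin t * cos t)) * (k - 1 / slope_recip t)) (at t)" .
    show "0 \<le> 2 * (1 / t + 1 / (sin t * cos t))" using p t by simp
  qed
  have "G z \<le> G y"
  proof (cases "z \<le> y")
    case True
    show ?thesis
    proof (rule DERIV_nonneg_imp_nondecreasing[OF True])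
      fix t assume t: "z \<le> t" "t \<le> y"
      have "1 / slope_recip t \<le> k" unfolding k_def
        using t y z slope_recip_mono[of z t] slope_recip_pos[of z] by (intro divide_left_mono) auto
      moreover have "0 < t" "t < pi / 2" using t y z by auto
      ultimately show "\<exists>d. DERIV G t :> d \<and> 0 \<le> d"
        using der[of t] pos[of t] by (meson diff_ge_0_iff_ge mult_nonneg_nonneg)
    qed
  next
    case False
    show ?thesis
    proof (rule DERIV_nonpos_imp_nonincreasing[of y z])
      fix t assume t: "y \<le> t" "t \<le> z"
      have "k \<le> 1 / slope_recip t" unfolding k_def
        using t y z slope_recip_mono[of t z] slope_recip_pos[of t] by (intro divide_left_mono) auto
      moreover have "0 < t" "t < pi / 2" using t y z by auto
      ultimately show "\<exists>d. DERIV G t :> d \<and> d \<le> 0"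
        using der[of t] pos[of t] by (meson diff_le_0_iff_le mult_nonneg_nonpos)
    qed (use False in simp)
  qed
  then show ?thesis
    using y z tan_gt_zero[of y] tan_gt_zero[of z] by (simp add: G_def k_def ln_mult algebra_simps)
qed

text \<open>For \<open>\<beta> = 0\<close>, \<open>\<nu>\<^sup>2\<close> is a multiple of \<open>1 / c\<^sup>2 = exp (- 2 ln c)\<close>, and the claim is the tangent inequality
  \<open>ln x \<le> x - 1\<close> for the exponential function. For \<open>\<beta> > 0\<close> it is the tangent inequality for the
  parametrised curve above.\<close>

lemma robin_frequency_tangent:
  assumes "\<beta> \<ge> 0" "h > 0" "robin_frequency \<beta> h \<kappa>"
  shows "\<exists>K\<ge>0. \<forall>c \<nu>. 0 < c \<longrightarrow> robin_frequency \<beta> c \<nu> \<longrightarrow> \<kappa>\<^sup>2 - K * (ln c - ln h) \<le> \<nu>\<^sup>2"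
proof (cases "\<beta> = 0")
  case True
  have freq: "\<nu> = pi / 2 / c" if "0 < c" "robin_frequency \<beta> c \<nu>" for c \<nu>
  proof -
    have "cos (c * \<nu>) = 0" "0 < c * \<nu>" "c * \<nu> \<le> pi / 2"
      using that True by (auto simp: robin_frequency_def)
    then have "c * \<nu> = pi / 2"
      by (metis cos_gt_zero less_numeral_extra(3) order_le_less)
    then show ?thesis using that by (simp add: field_simps)
  qed
  have "(pi / 2 / h)\<^sup>2 - 2 * (pi / 2 / h)\<^sup>2 * (ln c - ln h) \<le> (pi / 2 / c)\<^sup>2" if c: "0 < c" for c
  proof -
    have "ln ((h / c)\<^sup>2) \<le> (h / c)\<^sup>2 - 1"
      using c assms by (intro ln_le_minus_one) simp
    also have "ln ((h / c)\<^sup>2) = - 2 * (ln c - ln h)"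
      using c assms by (simp add: ln_realpow ln_div)
    finally have "(pi / 2 / h)\<^sup>2 * (1 - 2 * (ln c - ln h)) \<le> (pi / 2 / h)\<^sup>2 * (h / c)\<^sup>2"
      by (intro mult_left_mono) auto
    also have "(pi / 2 / h)\<^sup>2 * (h / c)\<^sup>2 = (pi / 2 / c)\<^sup>2"
      using assms c by (simp add: power_mult_distrib[symmetric])
    finally show ?thesis by (simp add: algebra_simps)
  qed
  then show ?thesis
    using freq freq[OF assms(2,3)] by (intro exI[of _ "2 * (pi / 2 / h)\<^sup>2"]) auto
next
  case False
  then have \<beta>: "\<beta> > 0" using assms by simp
  have freq: "0 < c * \<nu> \<and> c * \<nu> < pi / 2 \<and> c = \<beta> * (c * \<nu> * tan (c * \<nu>)) \<and> \<nu> = 1 / tan (c * \<nu>) / \<beta>"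
    if "0 < c" "robin_frequency \<beta> c \<nu>" for c \<nu>
  proof -
    have \<nu>: "0 < \<nu>" "0 < c * \<nu>" "c * \<nu> \<le> pi / 2" "\<beta> * \<nu> * sin (c * \<nu>) = cos (c * \<nu>)"
      using that by (auto simp: robin_frequency_def)
    have s: "sin (c * \<nu>) > 0" using \<nu> by (intro sin_gt_zero) auto
    then have c: "cos (c * \<nu>) > 0" using \<nu> \<beta> by (metis mult_pos_pos)
    then have "c * \<nu> \<noteq> pi / 2" by (intro notI) simp
    moreover have "\<beta> * \<nu> * tan (c * \<nu>) = 1"
      using \<nu>(4) c by (simp add: tan_def)
    moreover from this have "\<nu> = 1 / tan (c * \<nu>) / \<beta>"
      using \<beta> by (metis divide_divide_eq_left' mult.assoc mult.commute mult_zero_right nonzero_eq_divide_eq zero_neq_one)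
    moreover from \<open>\<beta> * \<nu> * tan (c * \<nu>) = 1\<close> have "c = \<beta> * (c * \<nu> * tan (c * \<nu>))"
      by (metis mult.assoc mult.commute mult.right_neutral)
    ultimately show ?thesis using \<nu> by linarith
  qed
  let ?z = "h * \<kappa>"
  let ?K = "2 / slope_recip ?z / \<beta>\<^sup>2"
  note fz = freq[OF assms(2,3)]
  have "\<kappa>\<^sup>2 - ?K * (ln c - ln h) \<le> \<nu>\<^sup>2" if "0 < c" "robin_frequency \<beta> c \<nu>" for c \<nu>
  proof -
    let ?y = "c * \<nu>"
    note fy = freq[OF that]
    have *: "ln c - ln h = ln (?y * tan ?y) - ln (?z * tan ?z)"
    proof -
      have "0 < tan ?y" "0 < tan ?z" using fy fz by (auto intro: tan_gt_zero)
      then have "ln (\<beta> * (?y * tan ?y)) = ln \<beta> + ln (?y * tan ?y)"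
        "ln (\<beta> * (?z * tan ?z)) = ln \<beta> + ln (?z * tan ?z)"
        using \<beta> fy fz by (auto intro!: ln_mult_pos mult_pos_pos)
      then show ?thesis using fy fz by simp
    qed
    have "((1 / tan ?z)\<^sup>2 - 2 / slope_recip ?z * (ln c - ln h)) / \<beta>\<^sup>2 \<le> (1 / tan ?y)\<^sup>2 / \<beta>\<^sup>2"
      unfolding * using fy fz by (intro divide_right_mono cot_square_tangent) auto
    also have "(1 / tan ?y)\<^sup>2 / \<beta>\<^sup>2 = \<nu>\<^sup>2" using fy by (metis power_divide)
    also have "((1 / tan ?z)\<^sup>2 - 2 / slope_recip ?z * (ln c - ln h)) / \<beta>\<^sup>2
        = (1 / tan ?z)\<^sup>2 / \<beta>\<^sup>2 - ?K * (ln c - ln h)"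
      by (simp add: diff_divide_distrib)
    also have "(1 / tan ?z)\<^sup>2 / \<beta>\<^sup>2 = \<kappa>\<^sup>2" using fz by (metis power_divide)
    finally show ?thesis .
  qed
  moreover have "?K \<ge> 0" using fz slope_recip_pos[of ?z] by simp
  ultimately show ?thesis by blast
qed

section \<open>Boxes with the perimeter of a cube\<close>

text \<open>The face areas, divided by those of the cube, are \<open>P\<^sub>j = \<Prod>\<^bsub>i \<noteq> j\<^esub> a\<^sub>i / h\<close>. Equal perimeter means that
  their mean is \<open>1\<close>, so that \<open>\<Sum>j. ln P\<^sub>j \<le> \<Sum>j. (P\<^sub>j - 1) = 0\<close>. Each \<open>ln (a\<^sub>i / h)\<close> occurs in \<open>N - 1\<close> of the
  \<open>ln P\<^sub>j\<close>, and \<open>N - 1 > 0\<close>.\<close>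

lemma equal_perimeter_sum_ln:
  fixes a :: "real ^ 'n"
  assumes N: "CARD('n) \<ge> 2" and a: "\<And>j. a $ j > 0" and h: "h > 0"
    and per: "box_perimeter a = box_perimeter ((\<chi> j. h) :: real ^ 'n)"
  shows "(\<Sum>j\<in>UNIV. ln (a $ j) - ln h) \<le> 0"
proof -
  let ?L = "\<Sum>j\<in>UNIV. ln (a $ j) - ln h"
  define P where "P j = (\<Prod>i\<in>UNIV - {j}. a $ i / h)" for j :: 'n
  have P: "P j > 0" for j unfolding P_def using a h by (intro prod_pos) auto
  have lnP: "ln (P j) = ?L - (ln (a $ j) - ln h)" for j
  proof -
    have "ln (P j) = (\<Sum>i\<in>UNIV - {j}. ln (a $ i / h))"
      unfolding P_def
    proof (rule ln_prod)
      show "a $ i / h \<noteq> 0" for i using a[of i] h by simp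
    qed simp
    also have "\<dots> = (\<Sum>i\<in>UNIV - {j}. ln (a $ i) - ln h)"
      using a[THEN less_imp_neq, symmetric] h by (intro sum.cong) (simp_all add: ln_div)
    also have "\<dots> = ?L - (ln (a $ j) - ln h)" by (simp add: sum_diff1)
    finally show ?thesis .
  qed
  have "(\<Sum>j\<in>UNIV. P j) = real CARD('n)"
  proof -
    let ?q = "(2 * h) ^ (CARD('n) - 1)"
    have "(\<Sum>j\<in>UNIV. \<Prod>i\<in>UNIV - {j}. 2 * a $ i) = real CARD('n) * ?q"
      using per h a by (subst (asm) (1 2) box_perimeter_eq) (auto simp: card_Diff_singleton)
    moreover have "(\<Prod>i\<in>UNIV - {j}. 2 * a $ i) = P j * ?q" for j
    proof -
      have "P j * ?q = (\<Prod>i\<in>UNIV - {j}. a $ i / h * (2 * h))"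
        unfolding P_def by (subst prod.distrib) (simp add: card_Diff_singleton)
      also have "\<dots> = (\<Prod>i\<in>UNIV - {j}. 2 * a $ i)" using h by (intro prod.cong) (simp_all add: field_simps)
      finally show ?thesis by simp
    qed
    ultimately show ?thesis using h by (simp add: sum_distrib_right[symmetric])
  qed
  then have "0 = (\<Sum>j\<in>UNIV. P j - 1)" by (simp add: sum_subtractf)
  also have "\<dots> \<ge> (\<Sum>j\<in>UNIV. ln (P j))" using P by (intro sum_mono ln_le_minus_one)
  also have "(\<Sum>j\<in>UNIV. ln (P j)) = (real CARD('n) - 1) * ?L"
  proof -
    have "(\<Sum>j\<in>UNIV. ln (P j)) = (\<Sum>j::'n\<in>UNIV. ?L) - ?L"
      by (simp only: lnP sum_subtractf[of "\<lambda>_. ?L"])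
    then show ?thesis by (simp only: sum_constant left_diff_distrib mult_1)
  qed
  finally have "(real CARD('n) - 1) * ?L \<le> 0" by simp
  then show ?thesis using N by (simp add: mult_le_0_iff)
qed

section \<open>Boundary and outward normals of a box\<close>

lemma has_real_derivative_along_line:
  fixes f :: "'a::real_inner \<Rightarrow> real"
  assumes "(f has_derivative (\<lambda>v. g \<bullet> v)) (at (x + t *\<^sub>R d))"
  shows "((\<lambda>t. f (x + t *\<^sub>R d)) has_real_derivative g \<bullet> d) (at t)"
proof -
  have "((\<lambda>t. x + t *\<^sub>R d) has_derivative (\<lambda>t. t *\<^sub>R d)) (at t)"
    by (auto intro!: derivative_eq_intros)
  from has_derivative_compose[OF this assms] show ?thesis
    by (simp add: has_field_derivative_def mult_commute_abs)
qed

lemma box_nonempty_pos: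
  fixes a :: "real ^ 'n"
  assumes "\<And>i. a $ i > 0"
  shows "box (- a) a \<noteq> {}"
proof -
  have "0 \<in> box (- a) a" using assms by (simp add: mem_box_cart)
  then show ?thesis by blast
qed

lemma closure_centred_box:
  fixes a :: "real ^ 'n"
  assumes "\<And>i. a $ i > 0"
  shows "closure (centred_box a) = {x. \<forall>i. \<bar>x $ i\<bar> \<le> a $ i}"
  using box_nonempty_pos[OF assms] by (auto simp: centred_box_def mem_box_cart abs_le_iff minus_le_iff)

lemma mem_centred_box: "x \<in> centred_box a \<longleftrightarrow> (\<forall>i. \<bar>x $ i\<bar> < a $ i)"
  by (auto simp: centred_box_def mem_box_cart abs_less_iff minus_less_iff)

lemma open_centred_box: "open (centred_box a)"
  by (simp add: centred_box_def open_box)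

lemma frontier_centred_box:
  fixes a :: "real ^ 'n"
  assumes "\<And>i. a $ i > 0"
  shows "frontier (centred_box a) = {x. (\<forall>i. \<bar>x $ i\<bar> \<le> a $ i) \<and> (\<exists>j. \<bar>x $ j\<bar> = a $ j)}"
  using closure_centred_box[of a, OF assms] interior_open[OF open_centred_box[of a]]
  by (force simp: frontier_def mem_centred_box order_less_le)

lemma eventually_enter_box:
  fixes a x d :: "real ^ 'n"
  assumes x: "\<And>i. \<bar>x $ i\<bar> \<le> a $ i" and a: "\<And>i. a $ i > 0"
    and d: "\<And>i. \<bar>x $ i\<bar> = a $ i \<Longrightarrow> sgn (x $ i) * d $ i < 0"
  shows "\<forall>\<^sub>F t in at_right 0. x + t *\<^sub>R d \<in> centred_box a"
proof -
  have "\<forall>\<^sub>F t in at_right 0. \<bar>x $ i + t * d $ i\<bar> < a $ i" for i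
  proof (cases "\<bar>x $ i\<bar> = a $ i")
    case False
    have "((\<lambda>t. \<bar>x $ i + t * d $ i\<bar>) \<longlongrightarrow> \<bar>x $ i + 0 * d $ i\<bar>) (at_right 0)"
      by (intro tendsto_intros)
    then show ?thesis using x[of i] False by (intro order_tendstoD) auto
  next
    case True
    have "\<forall>\<^sub>F t in at_right 0. 0 < t \<and> t * \<bar>d $ i\<bar> < a $ i"
    proof (intro eventually_conj)
      have "((\<lambda>t. t * \<bar>d $ i\<bar>) \<longlongrightarrow> 0 * \<bar>d $ i\<bar>) (at_right 0)"
        by (intro tendsto_intros)
      then show "\<forall>\<^sub>F t in at_right 0. t * \<bar>d $ i\<bar> < a $ i" using a[of i] by (intro order_tendstoD) auto
    qed (simp add: eventually_at_right_less)
    then show ?thesis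
    proof eventually_elim
      case (elim t)
      have *: "\<bar>t * d $ i\<bar> < a $ i" using elim by (simp add: abs_mult)
      show ?case
      proof (cases "x $ i > 0")
        case True
        then have "t * d $ i < 0" using elim d[of i] \<open>\<bar>x $ i\<bar> = a $ i\<close> by (simp add: mult_pos_neg)
        then show ?thesis using * True \<open>\<bar>x $ i\<bar> = a $ i\<close> by linarith
      next
        case False
        then have "x $ i < 0" using True a[of i] by auto
        then have "t * d $ i > 0" using elim d[of i] True by simp
        then show ?thesis using * \<open>x $ i < 0\<close> True by linarith
      qed
    qed
  qed
  then show ?thesis by (simp add: mem_centred_box eventually_all_finite)
qed

text \<open>Near a point with only its \<open>j\<close>-th coordinate extremal, the box is cut out by the single affine
  inequality \<open>sgn (x\<^sub>j) y\<^sub>j < a\<^sub>j\<close>.\<close>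

lemma outward_normal_open_face:
  fixes a x :: "real ^ 'n"
  assumes a: "\<And>i. a $ i > 0" and j: "\<bar>x $ j\<bar> = a $ j"
    and others: "\<And>i. i \<noteq> j \<Longrightarrow> \<bar>x $ i\<bar> < a $ i"
  shows "outward_normal (centred_box a) x (sgn (x $ j) *\<^sub>R axis j 1)"
  unfolding outward_normal_def
proof (intro conjI)
  let ?s = "sgn (x $ j)"
  have s: "?s * x $ j = a $ j" "?s \<noteq> 0" "\<bar>?s\<bar> = 1"
    using j a[of j] by (auto simp: sgn_if abs_if split: if_splits)
  have "\<bar>x $ i\<bar> \<le> a $ i" for i using j others[of i] by (cases "i = j") auto
  then show "x \<in> frontier (centred_box a)"
    using frontier_centred_box[of a, OF a] j by auto
  \<comment> \<open>On \<open>?U\<close> the other faces are out of reach, and \<open>\<bar>y\<^sub>j\<bar> = sgn (x\<^sub>j) y\<^sub>j\<close>.\<close>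
  let ?U = "{y. 0 < ?s * y $ j} \<inter> (\<Inter>i\<in>UNIV - {j}. {y. \<bar>y $ i\<bar> < a $ i})"
  have "open ?U"
    by (intro open_Int open_INT ballI open_Collect_less continuous_intros) auto
  moreover have "x \<in> ?U" using s a[of j] others by auto
  ultimately obtain r where r: "r > 0" "ball x r \<subseteq> ?U" by (rule openE)
  have "y \<in> centred_box a \<longleftrightarrow> ?s * y $ j - a $ j < 0" if "y \<in> ball x r" for y
  proof -
    have "y \<in> ?U" using that r(2) by (rule subsetD[rotated])
    then have y: "0 < ?s * y $ j" "\<And>i. i \<noteq> j \<Longrightarrow> \<bar>y $ i\<bar> < a $ i" by simp_all
    have "\<bar>y $ j\<bar> = ?s * y $ j"
      using y(1) by (auto simp: sgn_if split: if_splits)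
    moreover have "y \<in> centred_box a \<longleftrightarrow> \<bar>y $ j\<bar> < a $ j"
      using y(2) unfolding mem_centred_box by metis
    ultimately show ?thesis by auto
  qed
  then have set: "centred_box a \<inter> ball x r = {y \<in> ball x r. ?s * y $ j - a $ j < 0}" by blast
  have der: "((\<lambda>y. ?s * y $ j - a $ j) has_derivative (\<lambda>v. (?s *\<^sub>R axis j 1) \<bullet> v)) (at y)" for y
  proof -
    have "((\<lambda>y. y $ j) has_derivative (\<lambda>v. v $ j)) (at y)"
      by (rule bounded_linear_imp_has_derivative[OF bounded_linear_vec_nth])
    then show ?thesis by (auto intro!: derivative_eq_intros simp: inner_axis')
  qed
  show "\<exists>r>0. \<exists>\<rho> g. (\<forall>y\<in>ball x r. (\<rho> has_derivative (\<lambda>v. g y \<bullet> v)) (at y)) \<and>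
      continuous_on (ball x r) g \<and> g x \<noteq> 0 \<and>
      centred_box a \<inter> ball x r = {y \<in> ball x r. \<rho> y < 0} \<and>
      ?s *\<^sub>R axis j 1 = g x /\<^sub>R norm (g x)"
    using r s set der
    by (intro exI[of _ r] conjI exI[of _ "\<lambda>y. ?s * y $ j - a $ j"] exI[of _ "\<lambda>y. ?s *\<^sub>R axis j 1"])
       (auto simp: axis_eq_0_iff norm_axis_1)
qed

text \<open>Every direction \<open>d\<close> with \<open>g x \<bullet> d < 0\<close> leads into the sublevel set, hence into the box, and therefore
  does not point outwards through any face containing \<open>x\<close>. So an open half-space is contained in the
  closed half-space \<open>sgn (x\<^sub>j) d\<^sub>j \<le> 0\<close>, which forces \<open>g x\<close> to be a positive multiple of \<open>sgn (x\<^sub>j) e\<^sub>j\<close>.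
  This holds for any face through \<open>x\<close>, so edges and corners satisfy the boundary condition vacuously.\<close>

lemma outward_normal_box:
  fixes a x n :: "real ^ 'n"
  assumes a: "\<And>i. a $ i > 0" and j: "\<bar>x $ j\<bar> = a $ j"
    and "outward_normal (centred_box a) x n"
  shows "n = sgn (x $ j) *\<^sub>R axis j 1"
proof -
  let ?s = "sgn (x $ j)"
  obtain r \<rho> g where fr: "x \<in> frontier (centred_box a)" and r: "r > 0"
    and der: "\<And>y. y \<in> ball x r \<Longrightarrow> (\<rho> has_derivative (\<lambda>v. g y \<bullet> v)) (at y)"
    and g: "g x \<noteq> 0" and set: "centred_box a \<inter> ball x r = {y \<in> ball x r. \<rho> y < 0}"
    and n: "n = g x /\<^sub>R norm (g x)"
    using assms(3) unfolding outward_normal_def by blast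
  have xle: "\<And>i. \<bar>x $ i\<bar> \<le> a $ i" using fr frontier_centred_box[of a, OF a] by auto
  have s: "?s * x $ j = a $ j" "?s * ?s = 1"
    using j a[of j] by (auto simp: sgn_if abs_if split: if_splits)
  have line: "((\<lambda>t. \<rho> (x + t *\<^sub>R d)) has_real_derivative g x \<bullet> d) (at 0)" for d
    using der[of x] r by (intro has_real_derivative_along_line) simp
  have ball: "\<forall>\<^sub>F t in at_right 0. x + t *\<^sub>R d \<in> ball x r" for d
  proof -
    have "((\<lambda>t. x + t *\<^sub>R d) \<longlongrightarrow> x + 0 *\<^sub>R d) (at_right 0)" by (intro tendsto_intros)
    then show ?thesis using r by (intro topological_tendstoD) auto
  qed
  \<comment> \<open>The points \<open>x - t x\<close> lie in the box and tend to \<open>x\<close>.\<close>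
  have "\<rho> x \<le> 0"
  proof -
    have "\<forall>\<^sub>F t in at_right 0. \<rho> (x + t *\<^sub>R (- x)) \<le> 0"
    proof -
      have "sgn (x $ i) * (- x) $ i < 0" if "\<bar>x $ i\<bar> = a $ i" for i
        using that a[of i] by (auto simp: sgn_if abs_if split: if_splits)
      then have "\<forall>\<^sub>F t in at_right 0. x + t *\<^sub>R (- x) \<in> centred_box a"
        by (rule eventually_enter_box[OF xle a])
      from this ball[of "-x"] show ?thesis
      proof eventually_elim
        case (elim t)
        then have "\<rho> (x + t *\<^sub>R (- x)) < 0" using set by blast
        then show ?case by simp
      qed
    qed
    moreover have "((\<lambda>t. \<rho> (x + t *\<^sub>R (- x))) \<longlongrightarrow> \<rho> (x + 0 *\<^sub>R (- x))) (at_right 0)"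
      using DERIV_isCont[OF line[of "- x"]] unfolding isCont_def by (rule tendsto_mono[rotated]) (simp add: at_within_le_at)
    ultimately have "\<rho> (x + 0 *\<^sub>R (- x)) \<le> 0"
      by (intro tendsto_upperbound[where F = "at_right (0::real)"]) auto
    then show ?thesis by simp
  qed
  have half: "?s * d $ j \<le> 0" if d: "g x \<bullet> d < 0" for d
  proof -
    obtain e where e: "e > 0" "\<And>t. 0 < t \<Longrightarrow> t < e \<Longrightarrow> \<rho> (x + t *\<^sub>R d) < \<rho> x"
      using DERIV_neg_dec_right[OF line d] by auto
    have "\<forall>\<^sub>F t in at_right 0. 0 < t \<and> t < e"
      using e(1) by (auto simp: eventually_at_right_field)
    then have "\<forall>\<^sub>F t in at_right (0::real). ?s * d $ j \<le> 0" using ball[of d]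
    proof eventually_elim
      case (elim t)
      then have "\<rho> (x + t *\<^sub>R d) < 0" using e(2)[of t] \<open>\<rho> x \<le> 0\<close> by force
      then have "x + t *\<^sub>R d \<in> centred_box a" using set elim by blast
      then have "\<bar>x $ j + t * d $ j\<bar> < a $ j" by (simp add: mem_centred_box)
      then have "?s * (x $ j + t * d $ j) < ?s * x $ j"
        using s(1) by (simp add: sgn_if split: if_splits)
      then have "t * (?s * d $ j) < 0" by (simp add: algebra_simps)
      then show ?case using elim(1) unfolding mult_less_0_iff[of t] by linarith
    qed
    then show ?thesis by (simp add: trivial_limit_at_right_real)
  qed
  \<comment> \<open>The component \<open>d\<close> of \<open>e\<^sub>j\<close> orthogonal to \<open>g x\<close> is shown to be zero: since \<open>c d - g x\<close> is a direction of
    descent for every real \<open>c\<close>, the linear function \<open>c \<mapsto> c d\<^sub>j\<close> is bounded on one side.\<close>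
  define q where "q = (g x $ j) / (g x \<bullet> g x)"
  define d where "d = axis j 1 - q *\<^sub>R g x"
  have gg: "g x \<bullet> g x > 0" using g by simp
  have orth: "g x \<bullet> d = 0" using gg by (simp add: d_def q_def inner_diff_right inner_axis)
  have lin: "c * (?s * d $ j) \<le> ?s * g x $ j" for c
  proof -
    have "g x \<bullet> (c *\<^sub>R d - g x) < 0" using gg orth by (simp add: inner_diff_right)
    from half[OF this] show ?thesis by (simp add: algebra_simps)
  qed
  have dj: "d $ j = 0"
  proof (rule ccontr)
    assume "d $ j \<noteq> 0"
    then have "?s * d $ j \<noteq> 0" using s(2) by (metis mult_zero_left no_zero_divisors zero_neq_one)
    with lin[of "(?s * g x $ j + 1) / (?s * d $ j)"] show False by simp
  qed
  have "d \<bullet> d = d \<bullet> (axis j 1 - q *\<^sub>R g x)" by (simp add: d_def)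
  also have "\<dots> = d \<bullet> axis j 1 - q * (g x \<bullet> d)" by (simp add: inner_diff_right inner_commute)
  finally have "d = 0" using dj orth by (simp add: inner_axis)
  then have ax: "axis j 1 = q *\<^sub>R g x" by (simp add: d_def)
  then have "\<bar>q\<bar> * norm (g x) = 1" by (metis norm_axis_1 norm_scaleR)
  moreover have "?s * q = \<bar>q\<bar>"
  proof -
    have "0 \<le> ?s * g x $ j" using lin[of 0] by simp
    then have "0 \<le> ?s * q" using gg by (simp add: q_def)
    moreover have "\<bar>?s * q\<bar> = \<bar>q\<bar>" using s(2) by (simp add: abs_mult abs_sgn_eq split: if_splits)
    ultimately show ?thesis by simp
  qed
  ultimately have "?s * q = inverse (norm (g x))"
    using g by (simp add: field_simps)
  then show ?thesis by (simp add: n ax)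
qed

section \<open>Products of cosines as eigenfunctions\<close>

text \<open>The \<open>k\<close>-th derivative of \<open>t \<mapsto> cos (\<nu> t)\<close>: each differentiation shifts the phase by \<open>pi / 2\<close>. Products
  of such functions are closed under partial differentiation, so that one lemma
  yields gradient and Hessian.\<close>

definition cos_deriv :: "real \<Rightarrow> nat \<Rightarrow> real \<Rightarrow> real" where
  "cos_deriv \<nu> k t = \<nu> ^ k * cos (\<nu> * t + real k * (pi / 2))"

lemma cos_deriv_simps:
  "cos_deriv \<nu> 0 t = cos (\<nu> * t)"
  "cos_deriv \<nu> (Suc 0) t = - \<nu> * sin (\<nu> * t)"
  "cos_deriv \<nu> (Suc (Suc k)) t = - \<nu>\<^sup>2 * cos_deriv \<nu> k t"
proof -
  have "\<nu> * t + real (Suc (Suc k)) * (pi / 2) = \<nu> * t + real k * (pi / 2) + pi"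
    by (simp add: algebra_simps)
  then show "cos_deriv \<nu> (Suc (Suc k)) t = - \<nu>\<^sup>2 * cos_deriv \<nu> k t"
    unfolding cos_deriv_def by (simp only: cos_periodic_pi) (simp add: power2_eq_square)
qed (simp_all add: cos_deriv_def cos_add)

lemma has_derivative_cos_deriv:
  "(cos_deriv \<nu> k has_real_derivative cos_deriv \<nu> (Suc k) t) (at t)"
proof -
  have "((\<lambda>t. cos_deriv \<nu> k t) has_real_derivative \<nu> ^ k * (- sin (\<nu> * t + real k * (pi / 2)) * \<nu>)) (at t)"
    unfolding cos_deriv_def by (auto intro!: derivative_eq_intros)
  moreover have "\<nu> ^ k * (- sin (\<nu> * t + real k * (pi / 2)) * \<nu>) = cos_deriv \<nu> (Suc k) t"
  proof -
    have shift: "cos (s + pi / 2) = - sin s" for s :: real by (simp add: cos_add)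
    have "\<nu> * t + real (Suc k) * (pi / 2) = \<nu> * t + real k * (pi / 2) + pi / 2"
      by (simp add: algebra_simps)
    then show ?thesis unfolding cos_deriv_def by (simp only: shift) simp
  qed
  ultimately show ?thesis by simp
qed

text \<open>Here \<open>m\<close> is the multi-index of the partial derivative of \<open>\<Prod>i. cos (\<nu>\<^sub>i x\<^sub>i)\<close>.\<close>

definition cos_prod :: "real ^ 'n \<Rightarrow> ('n \<Rightarrow> nat) \<Rightarrow> real ^ 'n \<Rightarrow> real" where
  "cos_prod \<nu> m x = (\<Prod>i\<in>UNIV. cos_deriv (\<nu> $ i) (m i) (x $ i))"

definition cos_prod_grad :: "real ^ 'n \<Rightarrow> ('n \<Rightarrow> nat) \<Rightarrow> real ^ 'n \<Rightarrow> real ^ 'n" where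
  "cos_prod_grad \<nu> m x = (\<chi> j. cos_prod \<nu> (m(j := Suc (m j))) x)"

lemma cos_prod_update:
  "cos_prod \<nu> (m(j := k)) x = cos_deriv (\<nu> $ j) k (x $ j) * (\<Prod>i\<in>UNIV - {j}. cos_deriv (\<nu> $ i) (m i) (x $ i))"
  unfolding cos_prod_def by (subst prod.remove[of UNIV j]) auto

lemma has_derivative_cos_prod:
  "(cos_prod \<nu> m has_derivative (\<lambda>v. cos_prod_grad \<nu> m x \<bullet> v)) (at x)"
proof -
  have factor: "((\<lambda>x. cos_deriv (\<nu> $ i) (m i) (x $ i)) has_derivative
      (\<lambda>v. cos_deriv (\<nu> $ i) (Suc (m i)) (x $ i) * v $ i)) (at x)" for i
    by (rule has_derivative_compose[where f = "\<lambda>x. x $ i" and f' = "\<lambda>v. v $ i",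
          OF bounded_linear_imp_has_derivative[OF bounded_linear_vec_nth]
             has_derivative_cos_deriv[unfolded has_field_derivative_def]])
  have "(cos_prod \<nu> m has_derivative (\<lambda>v. \<Sum>i\<in>UNIV. cos_deriv (\<nu> $ i) (Suc (m i)) (x $ i) * v $ i *
      (\<Prod>j\<in>UNIV - {i}. cos_deriv (\<nu> $ j) (m j) (x $ j)))) (at x)"
    unfolding cos_prod_def[abs_def] by (intro has_derivative_prod factor)
  moreover have "(\<Sum>i\<in>UNIV. cos_deriv (\<nu> $ i) (Suc (m i)) (x $ i) * v $ i *
      (\<Prod>j\<in>UNIV - {i}. cos_deriv (\<nu> $ j) (m j) (x $ j))) = cos_prod_grad \<nu> m x \<bullet> v" for v
    by (simp add: inner_vec_def cos_prod_grad_def cos_prod_update mult.assoc mult.commute[of "v $ _"])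
  ultimately show ?thesis by simp
qed

lemma continuous_on_cos_prod: "continuous_on S (cos_prod \<nu> m)"
proof (rule has_derivative_continuous_on)
  show "(cos_prod \<nu> m has_derivative (\<lambda>v. cos_prod_grad \<nu> m x \<bullet> v)) (at x within S)" for x
    by (rule has_derivative_at_withinI[OF has_derivative_cos_prod])
qed

lemma continuous_on_cos_prod_grad: "continuous_on S (cos_prod_grad \<nu> m)"
  unfolding cos_prod_grad_def by (intro continuous_intros continuous_on_cos_prod)

definition cos_prod_hess :: "real ^ 'n \<Rightarrow> real ^ 'n \<Rightarrow> real ^ 'n ^ 'n" where
  "cos_prod_hess \<nu> x = (\<chi> j. cos_prod_grad \<nu> ((\<lambda>_. 0)(j := Suc 0)) x)"

lemma has_derivative_vec_componentwise:
  fixes f :: "'a::real_normed_vector \<Rightarrow> real ^ 'n"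
  assumes "\<And>j. ((\<lambda>x. f x $ j) has_derivative (\<lambda>v. f' v $ j)) (at y)"
  shows "(f has_derivative f') (at y)"
proof -
  have "\<forall>b\<in>Basis. ((\<lambda>x. f x \<bullet> b) has_derivative (\<lambda>v. f' v \<bullet> b)) (at y)"
    using assms by (auto simp: Basis_vec_def inner_axis)
  then show ?thesis using has_derivative_componentwise_within[of f f' y UNIV] by simp
qed

lemma has_derivative_cos_prod_grad:
  "(cos_prod_grad \<nu> (\<lambda>_. 0) has_derivative (\<lambda>v. cos_prod_hess \<nu> x *v v)) (at x)"
  using has_derivative_cos_prod[of \<nu> "(\<lambda>_. 0)(j := Suc 0)" x for j]
  by (intro has_derivative_vec_componentwise)
     (simp add: cos_prod_grad_def[of \<nu> "\<lambda>_. 0"] cos_prod_hess_def matrix_vector_mul_component)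

lemma trace_cos_prod_hess:
  "trace (cos_prod_hess \<nu> x) = - (\<Sum>j\<in>UNIV. (\<nu> $ j)\<^sup>2) * cos_prod \<nu> (\<lambda>_. 0) x"
proof -
  have "cos_prod_hess \<nu> x $ j $ j = - (\<nu> $ j)\<^sup>2 * cos_prod \<nu> (\<lambda>_. 0) x" for j
    using cos_prod_update[of \<nu> "\<lambda>_. 0" j 0 x]
    by (simp add: cos_prod_hess_def cos_prod_grad_def cos_prod_update cos_deriv_simps fun_upd_idem)
  then show ?thesis by (simp add: trace_def sum_negf sum_distrib_right)
qed

lemma cos_mult_pos:
  fixes \<nu> x :: real
  assumes "0 < \<nu>" "\<nu> * \<bar>x\<bar> < pi / 2"
  shows "0 < cos (\<nu> * x)"
proof (rule cos_gt_zero_pi)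
  have "\<bar>\<nu> * x\<bar> < pi / 2" using assms by (simp add: abs_mult)
  then show "- (pi / 2) < \<nu> * x" "\<nu> * x < pi / 2" by linarith+
qed

lemma cos_prod_pos:
  fixes a x :: "real ^ 'n"
  assumes "\<And>i. \<nu> $ i * \<bar>x $ i\<bar> < pi / 2" "\<And>i. 0 < \<nu> $ i"
  shows "0 < cos_prod \<nu> (\<lambda>_. 0) x"
  unfolding cos_prod_def using assms by (intro prod_pos) (simp add: cos_deriv_simps cos_mult_pos)

text \<open>All factors except the \<open>j\<close>-th split off, so on the \<open>j\<close>-th pair of faces the boundary expression vanishes
  when \<open>\<nu>\<^sub>j\<close> is a Robin frequency for \<open>a\<^sub>j\<close>, and is positive for a smaller frequency.\<close>

lemma cos_prod_outward_derivative:
  fixes a x \<nu> :: "real ^ 'n"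
  assumes "\<bar>x $ j\<bar> = a $ j" "a $ j > 0"
  shows "\<beta> * (sgn (x $ j) * cos_prod_grad \<nu> (\<lambda>_. 0) x $ j) + cos_prod \<nu> (\<lambda>_. 0) x
    = (cos (a $ j * \<nu> $ j) - \<beta> * \<nu> $ j * sin (a $ j * \<nu> $ j)) *
      (\<Prod>i\<in>UNIV - {j}. cos (\<nu> $ i * x $ i))"
proof -
  let ?s = "sgn (x $ j)" and ?R = "\<Prod>i\<in>UNIV - {j}. cos (\<nu> $ i * x $ i)"
  have s: "x $ j = ?s * a $ j" "?s = 1 \<or> ?s = -1"
    using assms by (auto simp: sgn_if abs_if split: if_splits)
  have "?s * sin (\<nu> $ j * x $ j) = sin (a $ j * \<nu> $ j)" "cos (\<nu> $ j * x $ j) = cos (a $ j * \<nu> $ j)"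
    using s by (auto simp: mult.commute)
  moreover have "cos_prod \<nu> (\<lambda>_. 0) x = cos (\<nu> $ j * x $ j) * ?R"
    using cos_prod_update[of \<nu> "\<lambda>_. 0" j 0 x] by (simp add: cos_deriv_simps fun_upd_idem)
  moreover have "cos_prod_grad \<nu> (\<lambda>_. 0) x $ j = - \<nu> $ j * sin (\<nu> $ j * x $ j) * ?R"
    by (simp add: cos_prod_grad_def cos_prod_update cos_deriv_simps)
  ultimately show ?thesis
    by (simp add: left_diff_distrib)
qed

lemma robin_eigenvalue_box:
  fixes a \<nu> :: "real ^ 'n"
  assumes a: "\<And>i. a $ i > 0" and \<nu>: "\<And>i. robin_frequency \<beta> (a $ i) (\<nu> $ i)"
  shows "robin_eigenvalue \<beta> (centred_box a) (\<Sum>j\<in>UNIV. (\<nu> $ j)\<^sup>2)"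
  unfolding robin_eigenvalue_def robin_eigenfunction_def
proof (intro exI conjI)
  let ?u = "cos_prod \<nu> (\<lambda>_. 0)" and ?g = "cos_prod_grad \<nu> (\<lambda>_. 0)" and ?H = "cos_prod_hess \<nu>"
  show "\<forall>x\<in>centred_box a. (?u has_derivative (\<lambda>v. ?g x \<bullet> v)) (at x)"
    by (simp add: has_derivative_cos_prod)
  show "\<forall>x\<in>centred_box a. (?g has_derivative (\<lambda>v. ?H x *v v)) (at x)"
    by (simp add: has_derivative_cos_prod_grad)
  show "continuous_on (centred_box a) ?H"
    unfolding cos_prod_hess_def by (intro continuous_intros continuous_on_cos_prod_grad)
  show "\<forall>x\<in>centred_box a. trace (?H x) + (\<Sum>j\<in>UNIV. (\<nu> $ j)\<^sup>2) * ?u x = 0"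
    by (simp add: trace_cos_prod_hess)
  show "\<forall>x n. outward_normal (centred_box a) x n \<longrightarrow> \<beta> * (?g x \<bullet> n) + ?u x = 0"
  proof (intro allI impI)
    fix x n assume n: "outward_normal (centred_box a) x n"
    then have "x \<in> frontier (centred_box a)" by (simp add: outward_normal_def)
    then obtain j where j: "\<bar>x $ j\<bar> = a $ j" using frontier_centred_box[of a, OF a] by auto
    have "\<beta> * \<nu> $ j * sin (a $ j * \<nu> $ j) = cos (a $ j * \<nu> $ j)"
      using \<nu>[of j] by (simp add: robin_frequency_def)
    with cos_prod_outward_derivative[where a = a and x = x and j = j, OF j a, of \<beta> \<nu>]
    show "\<beta> * (?g x \<bullet> n) + ?u x = 0"
      by (simp add: outward_normal_box[of a, OF a j n] inner_axis)
  qed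
  have "0 < ?u 0" using \<nu> by (intro cos_prod_pos) (auto simp: robin_frequency_def)
  then show "\<exists>x\<in>centred_box a. ?u x \<noteq> 0"
    using a by (intro bexI[of _ 0]) (auto simp: mem_centred_box)
qed (intro continuous_on_cos_prod continuous_on_cos_prod_grad)+

section \<open>A lower bound for every eigenvalue by the maximum principle\<close>

lemma second_derivative_nonpos_at_max:
  fixes f f' :: "real \<Rightarrow> real"
  assumes e: "e > 0" and f: "\<And>t. \<bar>t\<bar> < e \<Longrightarrow> (f has_real_derivative f' t) (at t)"
    and f': "(f' has_real_derivative D) (at 0)"
    and max: "\<And>t. \<bar>t\<bar> < e \<Longrightarrow> f t \<le> f 0"
  shows "D \<le> 0"
proof (rule ccontr)
  assume "\<not> D \<le> 0"
  have "f' 0 = 0"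
    by (rule DERIV_local_max[OF f[of 0]]) (use e max in auto)
  obtain d where d: "d > 0" "\<And>t. 0 < t \<Longrightarrow> t < d \<Longrightarrow> 0 < f' t"
    using DERIV_pos_inc_right[OF f'] \<open>\<not> D \<le> 0\<close> \<open>f' 0 = 0\<close> by auto
  define b where "b = min d e / 2"
  have b: "0 < b" "b < d" "b < e" using d(1) e by (auto simp: b_def min_def)
  have "f 0 < f b"
  proof (rule DERIV_pos_imp_increasing_open[OF b(1)])
    show "\<exists>y. (f has_real_derivative y) (at t) \<and> 0 < y" if "0 < t" "t < b" for t
      using f[of t] d(2)[of t] that b by auto
    show "continuous_on {0..b} f"
      using f b by (intro DERIV_atLeastAtMost_imp_continuous_on) force
  qed
  then show False using max[of b] b by auto
qed

text \<open>At an interior maximum, the restriction to each coordinate line has a nonpositive second derivative.\<close>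

lemma trace_hessian_nonpos_at_max:
  fixes v :: "real ^ 'n \<Rightarrow> real" and g :: "real ^ 'n \<Rightarrow> real ^ 'n"
  assumes S: "open S" "x \<in> S"
    and v: "\<And>y. y \<in> S \<Longrightarrow> (v has_derivative (\<lambda>w. g y \<bullet> w)) (at y)"
    and g: "(g has_derivative (\<lambda>w. H *v w)) (at x)"
    and max: "\<And>y. y \<in> S \<Longrightarrow> v y \<le> v x"
  shows "trace H \<le> 0"
proof -
  obtain e where e: "e > 0" "ball x e \<subseteq> S" using S by (rule openE)
  have "H $ j $ j \<le> 0" for j
  proof -
    have inS: "x + t *\<^sub>R axis j 1 \<in> S" if "\<bar>t\<bar> < e" for t
      using that e(2) by (intro subsetD[OF e(2)]) (simp add: dist_norm norm_axis_1)
    show ?thesis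
    proof (rule second_derivative_nonpos_at_max[OF e(1)])
      show "((\<lambda>t. v (x + t *\<^sub>R axis j 1)) has_real_derivative g (x + t *\<^sub>R axis j 1) \<bullet> axis j 1) (at t)"
        if "\<bar>t\<bar> < e" for t
        using inS[OF that] by (intro has_real_derivative_along_line v)
      have "((\<lambda>y. g y \<bullet> axis j 1) has_derivative (\<lambda>w. (H *v w) \<bullet> axis j 1)) (at x)"
        using g by (rule has_derivative_inner_left)
      then show "((\<lambda>t. g (x + t *\<^sub>R axis j 1) \<bullet> axis j 1) has_real_derivative H $ j $ j) (at 0)"
        using has_real_derivative_along_line[of "\<lambda>y. g y \<bullet> axis j 1" "H $ j" x 0 "axis j 1"]
        by (simp add: inner_axis matrix_vector_mul_component)
      show "v (x + t *\<^sub>R axis j 1) \<le> v (x + 0 *\<^sub>R axis j 1)" if "\<bar>t\<bar> < e" for t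
        using max[OF inS[OF that]] by simp
    qed
  qed
  then show ?thesis by (simp add: trace_def sum_nonpos)
qed

text \<open>At an edge or a corner the inward normal of one face can run inside another face, where nothing is
  known about differentiability. So one moves along the sum \<open>d\<close> of the inward normals of all faces
  through \<open>x\<close>: this direction enters the open box, and \<open>g\<close>, continuous up to the boundary, has a
  positive component along it.\<close>

lemma boundary_point_not_max:
  fixes a x :: "real ^ 'n" and v :: "real ^ 'n \<Rightarrow> real" and g :: "real ^ 'n \<Rightarrow> real ^ 'n"
  assumes a: "\<And>i. a $ i > 0" and x: "x \<in> frontier (centred_box a)"
    and v: "\<And>y. y \<in> centred_box a \<Longrightarrow> (v has_derivative (\<lambda>w. g y \<bullet> w)) (at y)"
    and contv: "continuous_on (closure (centred_box a)) v"
    and contg: "continuous_on (closure (centred_box a)) g"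
    and neg: "\<And>j. \<bar>x $ j\<bar> = a $ j \<Longrightarrow> sgn (x $ j) * g x $ j < 0"
  shows "\<exists>y\<in>centred_box a. v x < v y"
proof -
  have xcl: "x \<in> closure (centred_box a)" using x by (simp add: frontier_def)
  obtain k where k: "\<bar>x $ k\<bar> = a $ k" using x frontier_centred_box[of a, OF a] by auto
  have xle: "\<And>i. \<bar>x $ i\<bar> \<le> a $ i" using x frontier_centred_box[of a, OF a] by auto
  define d :: "real ^ 'n" where "d = (\<chi> i. if \<bar>x $ i\<bar> = a $ i then - sgn (x $ i) else 0)"
  have inward: "sgn (x $ i) * d $ i < 0" if "\<bar>x $ i\<bar> = a $ i" for i
    using that a[of i] by (auto simp: d_def sgn_if)
  have ev: "\<forall>\<^sub>F t in at_right 0. x + t *\<^sub>R d \<in> centred_box a"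
    using inward by (rule eventually_enter_box[OF xle a])
  have "0 < (\<Sum>i\<in>UNIV. g x $ i * d $ i)"
    using neg k by (intro sum_pos2[of _ k]) (auto simp: d_def mult.commute less_imp_le)
  then have gd: "0 < g x \<bullet> d" by (simp add: inner_vec_def)
  have "((\<lambda>t. x + t *\<^sub>R d) \<longlongrightarrow> x + 0 *\<^sub>R d) (at_right 0)" by (intro tendsto_intros)
  then have "((\<lambda>t. g (x + t *\<^sub>R d)) \<longlongrightarrow> g x) (at_right 0)"
    using xcl ev by (intro continuous_on_tendsto_compose[OF contg])
      (auto elim!: eventually_mono intro: subsetD[OF closure_subset])
  then have "((\<lambda>t. g (x + t *\<^sub>R d) \<bullet> d) \<longlongrightarrow> g x \<bullet> d) (at_right 0)" by (intro tendsto_intros)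
  from order_tendstoD(1)[OF this gd] ev
  have "\<forall>\<^sub>F t in at_right 0. 0 < g (x + t *\<^sub>R d) \<bullet> d \<and> x + t *\<^sub>R d \<in> centred_box a"
    by (rule eventually_conj)
  then obtain b where b: "b > 0" and
    pos: "\<And>t. 0 < t \<Longrightarrow> t < b \<Longrightarrow> 0 < g (x + t *\<^sub>R d) \<bullet> d \<and> x + t *\<^sub>R d \<in> centred_box a"
    by (auto simp: eventually_at_right_field)
  have "v (x + 0 *\<^sub>R d) < v (x + (b / 2) *\<^sub>R d)"
  proof (rule DERIV_pos_imp_increasing_open[where f = "\<lambda>t. v (x + t *\<^sub>R d)" and a = 0])
    show "\<exists>y. ((\<lambda>t. v (x + t *\<^sub>R d)) has_real_derivative y) (at t) \<and> 0 < y"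
      if "0 < t" "t < b / 2" for t
      using pos[of t] that has_real_derivative_along_line[OF v, of x t d] by auto
    have "x + t *\<^sub>R d \<in> closure (centred_box a)" if "0 \<le> t" "t \<le> b / 2" for t
      using pos[of t] xcl that b closure_subset by (cases "t = 0") force+
    then show "continuous_on {0..b / 2} (\<lambda>t. v (x + t *\<^sub>R d))"
      by (intro continuous_on_compose2[OF contv] continuous_intros) auto
  qed (use b in auto)
  then show ?thesis using pos[of "b / 2"] b by auto
qed

text \<open>The boundary condition is imposed only where there is a normal, that is, in the relative interiors of the
  faces. By continuity of \<open>u\<close> and \<open>g\<close> it persists in each closed face, with the normal of that face;
  a point is reached from the relative interior by shrinking its other coordinates.\<close>

lemma robin_condition_on_closed_face:
  fixes a x :: "real ^ 'n" and u :: "real ^ 'n \<Rightarrow> real" and g :: "real ^ 'n \<Rightarrow> real ^ 'n"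
  assumes a: "\<And>i. a $ i > 0" and x: "\<And>i. \<bar>x $ i\<bar> \<le> a $ i" and j: "\<bar>x $ j\<bar> = a $ j"
    and contu: "continuous_on (closure (centred_box a)) u"
    and contg: "continuous_on (closure (centred_box a)) g"
    and bc: "\<And>x n. outward_normal (centred_box a) x n \<Longrightarrow> \<beta> * (g x \<bullet> n) + u x = 0"
  shows "\<beta> * (sgn (x $ j) * g x $ j) + u x = 0"
proof -
  define y where "y t = (\<chi> i. if i = j then x $ j else t * x $ i)" for t
  have le: "\<bar>t * x $ i\<bar> \<le> t * a $ i" if "0 \<le> t" for t i
    using that x[of i] by (simp add: abs_mult mult_left_mono)
  have cl: "y t \<in> closure (centred_box a)" if "0 \<le> t" "t \<le> 1" for t
  proof -
    have "t * a $ i \<le> a $ i" for i using that a[of i] by (simp add: mult_left_le_one_le)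
    then have "\<bar>y t $ i\<bar> \<le> a $ i" for i
      using le[of t i] that x[of j] by (auto simp: y_def intro: order_trans)
    then show ?thesis by (simp add: closure_centred_box[of a, OF a])
  qed
  have conty: "continuous_on {0..1} y"
  proof -
    have "continuous_on {0..1} (\<lambda>t. if i = j then x $ j else t * x $ i)" for i
      by (cases "i = j") (auto intro!: continuous_intros)
    then show ?thesis unfolding y_def by (rule continuous_on_vec_lambda)
  qed
  have "continuous_on (closure {0<..<1}) (\<lambda>t. \<beta> * (sgn (x $ j) * g (y t) $ j) + u (y t))"
    using cl by (auto intro!: continuous_intros continuous_on_compose2[OF contu conty] continuous_on_compose2[OF contg conty])
  moreover have "\<beta> * (sgn (x $ j) * g (y t) $ j) + u (y t) = 0" if t: "t \<in> {0<..<1}" for t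
  proof -
    have "\<bar>y t $ i\<bar> < a $ i" if "i \<noteq> j" for i
    proof -
      have "t * a $ i < a $ i" using t a[of i] by simp
      then show ?thesis using le[of t i] t that by (simp add: y_def)
    qed
    then have "outward_normal (centred_box a) (y t) (sgn (y t $ j) *\<^sub>R axis j 1)"
      using j by (intro outward_normal_open_face a) (auto simp: y_def)
    from bc[OF this] show ?thesis by (simp add: inner_axis y_def)
  qed
  ultimately have "\<beta> * (sgn (x $ j) * g (y 1) $ j) + u (y 1) = 0"
    by (rule continuous_constant_on_closure) auto
  moreover have "y 1 = x" by (simp add: y_def vec_eq_iff)
  ultimately show ?thesis by simp
qed

text \<open>Let \<open>u > 0\<close> somewhere, and let \<open>M > 0\<close> be the maximum of \<open>u / \<phi>\<close>, attained at \<open>x\<close>. Then \<open>v = u - M \<phi>\<close> has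
  its maximum \<open>0\<close> at \<open>x\<close>. If \<open>x\<close> were on the boundary, then on each face through \<open>x\<close> the
  conditions on \<open>u\<close> and \<open>\<phi>\<close> would give \<open>\<beta> \<partial>v/\<partial>n = - M (\<beta> \<partial>\<phi>/\<partial>n + \<phi>) < 0\<close>, which contradicts maximality
  for \<open>\<beta> > 0\<close> and is absurd for \<open>\<beta> = 0\<close>. In the interior,
  \<open>0 \<ge> \<Delta>v \<ge> (L - l) M \<phi>\<close> at \<open>x\<close>.\<close>

lemma supersolution_eigenvalue_bound:
  fixes a :: "real ^ 'n" and \<phi> :: "real ^ 'n \<Rightarrow> real" and p :: "real ^ 'n \<Rightarrow> real ^ 'n"
    and Q :: "real ^ 'n \<Rightarrow> real ^ 'n ^ 'n"
  assumes a: "\<And>i. a $ i > 0" and \<beta>: "\<beta> \<ge> 0"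
    and \<phi>: "\<And>x. x \<in> centred_box a \<Longrightarrow> (\<phi> has_derivative (\<lambda>w. p x \<bullet> w)) (at x)"
    and p: "\<And>x. x \<in> centred_box a \<Longrightarrow> (p has_derivative (\<lambda>w. Q x *v w)) (at x)"
    and cont\<phi>: "continuous_on (closure (centred_box a)) \<phi>"
    and contp: "continuous_on (closure (centred_box a)) p"
    and pos: "\<And>x. x \<in> closure (centred_box a) \<Longrightarrow> 0 < \<phi> x"
    and lap: "\<And>x. x \<in> centred_box a \<Longrightarrow> trace (Q x) \<le> - L * \<phi> x"
    and strict: "\<And>x j. x \<in> frontier (centred_box a) \<Longrightarrow> \<bar>x $ j\<bar> = a $ j \<Longrightarrow>
                   0 < \<beta> * (sgn (x $ j) * p x $ j) + \<phi> x"
    and ev: "robin_eigenvalue \<beta> (centred_box a) l"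
  shows "L \<le> l"
proof -
  let ?B = "centred_box a"
  obtain u g H x0 where
    u: "\<And>x. x \<in> ?B \<Longrightarrow> (u has_derivative (\<lambda>v. g x \<bullet> v)) (at x)" and
    g: "\<And>x. x \<in> ?B \<Longrightarrow> (g has_derivative (\<lambda>v. H x *v v)) (at x)" and
    contu: "continuous_on (closure ?B) u" and contg: "continuous_on (closure ?B) g" and
    eq: "\<And>x. x \<in> ?B \<Longrightarrow> trace (H x) + l * u x = 0" and
    bc: "\<And>x n. outward_normal ?B x n \<Longrightarrow> \<beta> * (g x \<bullet> n) + u x = 0" and
    x0: "x0 \<in> ?B" "0 < u x0"
  proof -
    obtain u g H x0 where e:
      "\<And>x. x \<in> ?B \<Longrightarrow> (u has_derivative (\<lambda>v. g x \<bullet> v)) (at x)"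
      "\<And>x. x \<in> ?B \<Longrightarrow> (g has_derivative (\<lambda>v. H x *v v)) (at x)"
      "continuous_on (closure ?B) u" "continuous_on (closure ?B) g"
      "\<And>x. x \<in> ?B \<Longrightarrow> trace (H x) + l * u x = 0"
      "\<And>x n. outward_normal ?B x n \<Longrightarrow> \<beta> * (g x \<bullet> n) + u x = 0"
      "x0 \<in> ?B" "u x0 \<noteq> 0"
      using ev unfolding robin_eigenvalue_def robin_eigenfunction_def by blast
    \<comment> \<open>The problem is linear, so the sign of an eigenfunction can be chosen.\<close>
    define s where "s = sgn (u x0)"
    show thesis
    proof (rule that[of "\<lambda>x. s * u x" "\<lambda>x. s *\<^sub>R g x" "\<lambda>x. s *\<^sub>R H x" x0])
      show "((\<lambda>x. s * u x) has_derivative (\<lambda>v. (s *\<^sub>R g x) \<bullet> v)) (at x)" if "x \<in> ?B" for x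
        using has_derivative_mult_right[OF e(1)[OF that], of s] by simp
      show "((\<lambda>x. s *\<^sub>R g x) has_derivative (\<lambda>v. (s *\<^sub>R H x) *v v)) (at x)" if "x \<in> ?B" for x
        using has_derivative_scaleR_right[OF e(2)[OF that], of s]
        by (simp add: scaleR_matrix_vector_assoc)
      show "trace (s *\<^sub>R H x) + l * (s * u x) = 0" if "x \<in> ?B" for x
      proof -
        have "trace (s *\<^sub>R H x) = s * trace (H x)" by (simp add: trace_def sum_distrib_left)
        then have "trace (s *\<^sub>R H x) + l * (s * u x) = s * (trace (H x) + l * u x)"
          by (simp add: algebra_simps)
        then show ?thesis using e(5)[OF that] by simp
      qed
      show "\<beta> * (s *\<^sub>R g x \<bullet> n) + s * u x = 0" if "outward_normal ?B x n" for x n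
      proof -
        have "\<beta> * (s *\<^sub>R g x \<bullet> n) + s * u x = s * (\<beta> * (g x \<bullet> n) + u x)" by (simp add: algebra_simps)
        then show ?thesis using e(6)[OF that] by simp
      qed
      show "0 < s * u x0" using e(8) by (simp add: s_def sgn_if)
    qed (use e in \<open>auto intro!: continuous_intros\<close>)
  qed
  have "compact (closure ?B)" by (simp add: centred_box_def bounded_box)
  moreover have "x0 \<in> closure ?B" using x0 closure_subset by blast
  moreover have "continuous_on (closure ?B) (\<lambda>x. u x / \<phi> x)"
    by (intro continuous_on_divide contu cont\<phi> ballI less_imp_neq[OF pos, symmetric])
  ultimately have "\<exists>x\<in>closure ?B. \<forall>y\<in>closure ?B. u y / \<phi> y \<le> u x / \<phi> x"
    by (intro continuous_attains_sup) auto
  then obtain x where x: "x \<in> closure ?B"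
    and max: "\<And>y. y \<in> closure ?B \<Longrightarrow> u y / \<phi> y \<le> u x / \<phi> x" by blast
  define M where "M = u x / \<phi> x"
  have "0 < u x0 / \<phi> x0" using x0 pos \<open>x0 \<in> closure ?B\<close> by simp
  also have "\<dots> \<le> M" unfolding M_def using max \<open>x0 \<in> closure ?B\<close> by blast
  finally have M: "M > 0" .
  define v where "v y = u y - M * \<phi> y" for y
  define q where "q y = g y - M *\<^sub>R p y" for y
  have vx: "v x = 0" using pos[OF x] by (simp add: v_def M_def)
  have vle: "v y \<le> v x" if "y \<in> closure ?B" for y
  proof -
    have "u y \<le> M * \<phi> y" using max[OF that] pos[OF that] by (simp add: M_def[symmetric] divide_le_eq)
    then show ?thesis unfolding vx by (simp add: v_def)
  qed
  have dv: "(v has_derivative (\<lambda>w. q y \<bullet> w)) (at y)" if "y \<in> ?B" for y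
  proof -
    have "(v has_derivative (\<lambda>w. g y \<bullet> w - M * (p y \<bullet> w))) (at y)"
      unfolding v_def[abs_def] using that by (intro derivative_intros u \<phi> has_derivative_mult_right)
    then show ?thesis by (simp add: q_def inner_diff_left)
  qed
  have "x \<in> ?B"
  proof (rule ccontr)
    assume "x \<notin> ?B"
    then have fr: "x \<in> frontier ?B" using x by (simp add: frontier_def interior_open[OF open_centred_box])
    have xle: "\<And>i. \<bar>x $ i\<bar> \<le> a $ i" using x by (simp add: closure_centred_box[of a, OF a])
    have "sgn (x $ j) * q x $ j < 0" if j: "\<bar>x $ j\<bar> = a $ j" for j
    proof -
      have "\<beta> * (sgn (x $ j) * g x $ j) + u x = 0"
        by (rule robin_condition_on_closed_face[OF a xle j contu contg bc])
      moreover have "0 < M * (\<beta> * (sgn (x $ j) * p x $ j) + \<phi> x)"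
        using M strict[OF fr j] by simp
      moreover have "u x = M * \<phi> x" using vx by (simp add: v_def)
      ultimately have "\<beta> * (sgn (x $ j) * q x $ j) < 0"
        by (simp add: q_def algebra_simps)
      then show ?thesis using \<beta> by (simp add: mult_less_0_iff)
    qed
    then have "\<exists>y\<in>?B. v x < v y"
    proof (intro boundary_point_not_max[OF a fr dv])
      show "continuous_on (closure ?B) v" unfolding v_def[abs_def]
        by (intro continuous_intros contu cont\<phi>)
      show "continuous_on (closure ?B) q" unfolding q_def[abs_def]
        by (intro continuous_intros contg contp)
    qed
    then show False using vle closure_subset by (meson linorder_not_less subsetD)
  qed
  have dq: "(q has_derivative (\<lambda>w. (H x - M *\<^sub>R Q x) *v w)) (at x)"
  proof -
    have "(q has_derivative (\<lambda>w. H x *v w - M *\<^sub>R (Q x *v w))) (at x)"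
      unfolding q_def[abs_def] using \<open>x \<in> ?B\<close> by (intro derivative_intros g p has_derivative_scaleR_right)
    then show ?thesis by (simp add: matrix_vector_mult_diff_rdistrib scaleR_matrix_vector_assoc)
  qed
  have "trace (H x - M *\<^sub>R Q x) \<le> 0"
    using vle closure_subset by (intro trace_hessian_nonpos_at_max[OF open_centred_box \<open>x \<in> ?B\<close> dv dq]) auto
  moreover have "trace (H x - M *\<^sub>R Q x) = trace (H x) - M * trace (Q x)"
    by (simp add: trace_def sum_subtractf sum_distrib_left)
  moreover have "trace (H x) = - l * (M * \<phi> x)"
    using eq[OF \<open>x \<in> ?B\<close>] vx by (simp add: v_def)
  moreover have "M * trace (Q x) \<le> M * (- L * \<phi> x)"
    using lap[OF \<open>x \<in> ?B\<close>] M by (intro mult_left_mono) auto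
  ultimately have "L * (M * \<phi> x) \<le> l * (M * \<phi> x)" by (simp add: algebra_simps)
  then show ?thesis using M pos[OF x] by simp
qed

text \<open>With the frequencies \<open>\<nu>\<^sub>i\<close> themselves, the product of cosines satisfies the boundary condition with
  equality, and for \<open>\<beta> = 0\<close> it vanishes on the boundary. The frequencies \<open>t \<nu>\<^sub>i\<close> with \<open>t < 1\<close> make it a
  positive strict supersolution, and then \<open>t\<close> tends to \<open>1\<close>.\<close>

lemma robin_eigenvalue_box_ge:
  fixes a \<nu> :: "real ^ 'n"
  assumes a: "\<And>i. a $ i > 0" and \<beta>: "\<beta> \<ge> 0" and \<nu>: "\<And>i. robin_frequency \<beta> (a $ i) (\<nu> $ i)"
    and ev: "robin_eigenvalue \<beta> (centred_box a) l"
  shows "(\<Sum>j\<in>UNIV. (\<nu> $ j)\<^sup>2) \<le> l"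
proof -
  have shrunk: "(\<Sum>j\<in>UNIV. ((t *\<^sub>R \<nu>) $ j)\<^sup>2) \<le> l" if t: "0 < t" "t < 1" for t
  proof -
    let ?\<nu> = "t *\<^sub>R \<nu>"
    have freq: "0 < \<nu> $ i" "a $ i * \<nu> $ i \<le> pi / 2"
      "\<beta> * \<nu> $ i * sin (a $ i * \<nu> $ i) = cos (a $ i * \<nu> $ i)" for i
      using \<nu>[of i] by (auto simp: robin_frequency_def)
    have less: "a $ i * (t * \<nu> $ i) < a $ i * \<nu> $ i" for i
      using t a[of i] freq(1)[of i] by simp
    have small: "?\<nu> $ i * \<bar>x $ i\<bar> < pi / 2" if "x \<in> closure (centred_box a)" for x i
    proof -
      have "t * \<nu> $ i * \<bar>x $ i\<bar> \<le> t * \<nu> $ i * a $ i"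
        using that t freq(1)[of i] by (intro mult_left_mono) (auto simp: closure_centred_box[of a, OF a])
      then show ?thesis using less[of i] freq(2)[of i] by (simp add: mult_ac)
    qed
    have strict: "0 < \<beta> * (sgn (x $ j) * cos_prod_grad ?\<nu> (\<lambda>_. 0) x $ j) + cos_prod ?\<nu> (\<lambda>_. 0) x"
      if x: "x \<in> closure (centred_box a)" and j: "\<bar>x $ j\<bar> = a $ j" for x j
    proof -
      have half: "a $ j * (t * \<nu> $ j) \<le> pi / 2" "a $ j * (t * \<nu> $ j) \<le> pi" "a $ j * \<nu> $ j \<le> pi"
        using less[of j] freq(2)[of j] pi_gt_zero by linarith+
      have "\<beta> * (t * \<nu> $ j) * sin (a $ j * (t * \<nu> $ j)) \<le> \<beta> * \<nu> $ j * sin (a $ j * \<nu> $ j)"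
        using t \<beta> a[of j] freq[of j] less[of j]
        by (intro mult_mono mult_left_mono sin_monotone_2pi_le sin_ge_zero half) (auto intro: order_trans[of _ 0])
      also have "\<dots> < cos (a $ j * (t * \<nu> $ j))"
        unfolding freq(3) using t a[of j] freq[of j] less[of j] by (intro cos_monotone_0_pi half) auto
      finally have "0 < cos (a $ j * ?\<nu> $ j) - \<beta> * ?\<nu> $ j * sin (a $ j * ?\<nu> $ j)" by simp
      moreover have "0 < (\<Prod>i\<in>UNIV - {j}. cos (?\<nu> $ i * x $ i))"
        using small[OF x] freq(1) t by (intro prod_pos cos_mult_pos) auto
      ultimately show ?thesis
        unfolding cos_prod_outward_derivative[where a = a and x = x and j = j, OF j a] by simp
    qed
    show ?thesis
    proof (rule supersolution_eigenvalue_bound[OF a \<beta> has_derivative_cos_prod has_derivative_cos_prod_grad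
          continuous_on_cos_prod continuous_on_cos_prod_grad _ _ strict ev])
      show "0 < cos_prod ?\<nu> (\<lambda>_. 0) x" if "x \<in> closure (centred_box a)" for x
        using small[OF that] freq(1) t by (intro cos_prod_pos) auto
    qed (auto simp: trace_cos_prod_hess frontier_def)
  qed
  have "((\<lambda>t. \<Sum>j\<in>UNIV. ((t *\<^sub>R \<nu>) $ j)\<^sup>2) \<longlongrightarrow> (\<Sum>j\<in>UNIV. ((1 *\<^sub>R \<nu>) $ j)\<^sup>2)) (at_left 1)"
    by (intro tendsto_intros)
  moreover have "\<forall>\<^sub>F t in at_left 1. 0 < t \<and> t < (1::real)"
    by (auto simp: eventually_at_left_field intro: exI[of _ 0])
  then have "\<forall>\<^sub>F t in at_left 1. (\<Sum>j\<in>UNIV. ((t *\<^sub>R \<nu>) $ j)\<^sup>2) \<le> l"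
    by eventually_elim (simp add: shrunk del: vector_scaleR_component)
  ultimately have "(\<Sum>j\<in>UNIV. ((1 *\<^sub>R \<nu>) $ j)\<^sup>2) \<le> l"
    by (intro tendsto_upperbound) auto
  then show ?thesis by simp
qed

section \<open>The fundamental eigenvalue and the isoperimetric inequality\<close>

lemma fundamental_robin_eigenvalue_box:
  fixes a \<nu> :: "real ^ 'n"
  assumes "\<And>i. a $ i > 0" "\<beta> \<ge> 0" "\<And>i. robin_frequency \<beta> (a $ i) (\<nu> $ i)"
  shows "fundamental_robin_eigenvalue \<beta> (centred_box a) = (\<Sum>j\<in>UNIV. (\<nu> $ j)\<^sup>2)"
  unfolding fundamental_robin_eigenvalue_def
proof (rule Least_equality)
  show "robin_eigenvalue \<beta> (centred_box a) (\<Sum>j\<in>UNIV. (\<nu> $ j)\<^sup>2)"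
    by (rule robin_eigenvalue_box[OF assms(1,3)])
  show "(\<Sum>j\<in>UNIV. (\<nu> $ j)\<^sup>2) \<le> l" if "robin_eigenvalue \<beta> (centred_box a) l" for l
    by (rule robin_eigenvalue_box_ge[OF assms that])
qed

theorem corollary2:
  fixes a :: "real ^ 'n" and \<beta> h :: real
  assumes "CARD('n) \<ge> 2"
    and "\<beta> \<ge> 0"
    and "\<And>j. a $ j > 0"
    and "h > 0"
    and "box_perimeter a = box_perimeter ((\<chi> j. h) :: real ^ 'n)"
  shows "fundamental_robin_eigenvalue \<beta> (centred_box a)
         \<ge> fundamental_robin_eigenvalue \<beta> (centred_box ((\<chi> j. h) :: real ^ 'n))"
proof -
  have "\<exists>\<nu>. \<forall>j. robin_frequency \<beta> (a $ j) (\<nu> j)"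
    by (intro choice allI robin_frequency_exists assms)
  then obtain f where f: "\<And>j. robin_frequency \<beta> (a $ j) (f j)" by blast
  define \<nu> :: "real ^ 'n" where "\<nu> = (\<chi> j. f j)"
  have \<nu>: "\<And>j. robin_frequency \<beta> (a $ j) (\<nu> $ j)" by (simp add: \<nu>_def f)
  obtain \<kappa> where \<kappa>: "robin_frequency \<beta> h \<kappa>"
    using robin_frequency_exists[OF assms(2,4)] by blast
  obtain K where K: "K \<ge> 0"
    and tangent: "\<And>c \<nu>. 0 < c \<Longrightarrow> robin_frequency \<beta> c \<nu> \<Longrightarrow> \<kappa>\<^sup>2 - K * (ln c - ln h) \<le> \<nu>\<^sup>2"
    using robin_frequency_tangent[OF assms(2,4) \<kappa>] by blast
  have "fundamental_robin_eigenvalue \<beta> (centred_box ((\<chi> j. h) :: real ^ 'n)) = (\<Sum>j\<in>(UNIV :: 'n set). \<kappa>\<^sup>2)"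
    by (subst fundamental_robin_eigenvalue_box[where \<nu> = "\<chi> j. \<kappa>"]) (use assms \<kappa> in auto)
  also have "\<dots> \<le> (\<Sum>j\<in>(UNIV :: 'n set). \<kappa>\<^sup>2) - K * (\<Sum>j\<in>UNIV. ln (a $ j) - ln h)"
    using mult_nonneg_nonpos[OF K equal_perimeter_sum_ln[OF assms(1,3,4,5)]] by simp
  also have "\<dots> = (\<Sum>j\<in>UNIV. \<kappa>\<^sup>2 - K * (ln (a $ j) - ln h))"
    by (simp only: sum_subtractf[of "\<lambda>_. \<kappa>\<^sup>2"] sum_distrib_left)
  also have "\<dots> \<le> (\<Sum>j\<in>UNIV. (\<nu> $ j)\<^sup>2)"
    by (intro sum_mono tangent assms \<nu>)
  also have "\<dots> = fundamental_robin_eigenvalue \<beta> (centred_box a)"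
    by (rule fundamental_robin_eigenvalue_box[OF assms(3,2) \<nu>, symmetric])
  finally show ?thesis .
qed

end
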